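(* Consider the two-project, two-backer crowdfunding model described in the context, with backer contentedness $\mathcal{C}$ as performance metric. Observational learning has no potential to harm backer contentedness in any of the four quality states, i.e. $\mathcal{P}_{\mathcal{C}^-}(V)=\emptyset$ for all $V\in\mathcal{V}$, and it strictly improves backer contentedness, on average, in all four quality states, i.e. $\delta_{\mathcal{C}^{\mathrm{ave}}}(V)>0$ for all $V\in\mathcal{V}$. The maximum improvement potential and average impact of observational learning on backer contentedness in each quality state are as follows: $$\delta_{\mathcal{C}^+}(V)=\begin{cases}0.74,&V=(0,0)\\0.45,&V=(1,0),(0,1)\\0.25,&V=(1,1)\end{cases}\qquad \delta_{\mathcal{C}^{\mathrm{ave}}}(V)=\begin{cases}0.08,&V=(0,0)\\0.05,&V=(1,0),(0,1)\\0.03,&V=(1,1).\end{cases}$$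
   Context: Model. There are two projects $i=1,2$ with true quality state $V=(V^1,V^2)\in\mathcal{V}=\{0,1\}^2$ ($1$ = high, $0$ = low quality), and $N=2$ backers $j=1,2$ who arrive sequentially, with expertness levels $p=(p_1,p_2)$; the evaluation below considers $p\in(0.5,1)^2$. Given $V$, backer $j$ receives a private signal pair $s_j=(s_j^1,s_j^2)\in\mathcal{S}=\{H,L\}^2$; the signals are independent across projects and backers given $V$, with $P(s_j^i=H\mid V^i=1)=P(s_j^i=L\mid V^i=0)=p_j$ and $P(s_j^i=H\mid V^i=0)=P(s_j^i=L\mid V^i=1)=1-p_j$. Backer $j$ makes a decision $x_j\in\{0,1,2\}$ ($x_j=i\in\{1,2\}$: pledges to project $i$; $x_j=0$: does not pledge). Backers are unbiased before receiving their signals (all states in $\mathcal{V}$ have equal prior weight). Decision rule. Given an information set $I_j$, backer $j$ forms the posterior $P(\cdot\mid I_j)$ on $\mathcal{V}$ and then decides randomly with $P(x_j=1\mid I_j)=P(V^1=1,V^2=0\mid I_j)+0.5\,P(V^1=1,V^2=1\mid I_j)$, $P(x_j=2\mid I_j)=P(V^1=0,V^2=1\mid I_j)+0.5\,P(V^1=1,V^2=1\mid I_j)$, $P(x_j=0\mid I_j)=P(V^1=0,V^2=0\mid I_j)$. No learning (NL): each backer uses only his or her own signals, $I_j=\{s_j\}$, so $P(V\mid s_j)=P(s_j^1\mid V)P(s_j^2\mid V)\big/\sum_{V'\in\mathcal V}P(s_j^1\mid V')P(s_j^2\mid V')$. Observational learning (OL): $I_1=\{s_1\}$ as in NL, while the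 second backer also observes the first decision, $I_2=\{s_2,x_1\}$, with $P(V\mid s_2,x_1)=\dfrac{P(s_2^1\mid V)P(s_2^2\mid V)P(x_1\mid V)}{\sum_{V'\in\mathcal V}P(s_2^1\mid V')P(s_2^2\mid V')P(x_1\mid V')}$, where $P(x_1\mid V)=\sum_{s_1\in\mathcal{S}}P(x_1\mid s_1)P(s_1^1\mid V)P(s_1^2\mid V)$. Metric. Let $n_i(V,p)$ be the random number of backers pledging to project $i$ when the true state is $V$ and the expertness levels are $p$. Backer contentedness $\mathcal{C}(V,p)$ is $\mathbb{E}[n_1(V,p)]+\mathbb{E}[n_2(V,p)]$ if $V=(1,1)$; $\mathbb{E}[n_1(V,p)]$ if $V=(1,0)$; $\mathbb{E}[n_2(V,p)]$ if $V=(0,1)$; $N-(\mathbb{E}[n_1(V,p)]+\mathbb{E}[n_2(V,p)])$ if $V=(0,0)$. Superscripts OL and NL indicate the value of a metric with and without observational learning. Evaluation. For a metric $\mu$, $\mathcal{P}_{\mu^+}(V)=\{p\in(0.5,1)^2:\mu^{OL}(V,p)-\mu^{NL}(V,p)\ge0\}$ and $\mathcal{P}_{\mu^-}(V)=\{p\in(0.5,1)^2:\mu^{OL}(V,p)-\mu^{NL}(V,p)<0\}$. OL is said to have harm potential for $\mu$ in state $V$ when $\mathcal{P}_{\mu^-}(V)\ne\emptyset$. The maximum improvement potential is $\delta_{\mu^+}(V)=\max_{p\in\mathcal{P}_{\mu^+}(V)}\{\mu^{OL}(V,p)-\mu^{NL}(V,p)\}$, and the average impact is $\delta_{\mu^{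\mathrm{ave}}}(V)=\iint_{(0.5,1)^2}2^2\big(\mu^{OL}(V,p)-\mu^{NL}(V,p)\big)\,dp_2\,dp_1$.
   Formalization: The max over the open square is not attained, so it is read as a supremum; the suprema 3/4 and 11/24 do not round to 0.74 and 0.45, so these are stated as lying in [0.74,0.75] and [0.45,0.46]; 0.25 and the averages are stated to within 0.005. *)

theory Defs
  imports "HOL-Probability.Probability"
begin

text \<open>A quality state is the pair of the two projects' qualities; True is high quality.\<close>
type_synonym state = "bool \<times> bool"

datatype signal = H | L
datatype project = Project1 | Project2
datatype decision = No_Pledge | Pledge project

definition signal_pmf :: "real \<Rightarrow> bool \<Rightarrow> signal pmf" where
  "signal_pmf p v = map_pmf (\<lambda>b. if b then H else L) (bernoulli_pmf (if v then p else 1 - p))"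

definition signals_pmf :: "real \<Rightarrow> state \<Rightarrow> (signal \<times> signal) pmf" where
  "signals_pmf p V = pair_pmf (signal_pmf p (fst V)) (signal_pmf p (snd V))"

text \<open>Bayes' rule for a likelihood on the states. The prior is uniform and cancels.\<close>
definition posterior :: "(state \<Rightarrow> real) \<Rightarrow> state \<Rightarrow> real" where
  "posterior l V = l V / (\<Sum>V'\<in>UNIV. l V')"

fun decision_prob :: "(state \<Rightarrow> real) \<Rightarrow> decision \<Rightarrow> real" where
  "decision_prob q (Pledge Project1) = q (True, False) + 1/2 * q (True, True)"
| "decision_prob q (Pledge Project2) = q (False, True) + 1/2 * q (True, True)"
| "decision_prob q No_Pledge = q (False, False)"

text \<open>The random decision under belief q. By the lemmas below, the weights do form a
  probability distribution whenever q is a posterior.\<close>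
definition decide :: "(state \<Rightarrow> real) \<Rightarrow> decision pmf" where
  "decide q = embed_pmf (decision_prob q)"

lemma sum_state: "(\<Sum>V\<in>UNIV. f V) =
    f (True, True) + f (True, False) + f (False, True) + (f (False, False) :: real)"
  by (simp add: UNIV_Times_UNIV[symmetric] UNIV_bool sum.cartesian_product[symmetric]
           del: UNIV_Times_UNIV)

lemma UNIV_decision: "UNIV = {No_Pledge, Pledge Project1, Pledge Project2}"
proof -
  have "x \<in> {No_Pledge, Pledge Project1, Pledge Project2}" for x
    by (cases x; simp; metis project.exhaust)
  then show ?thesis by blast
qed

lemma pmf_decide:
  assumes "\<And>V. 0 \<le> q V" and "(\<Sum>V\<in>UNIV. q V) = 1"
  shows "pmf (decide q) x = decision_prob q x"
  unfolding decide_def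
proof (rule pmf_embed_pmf)
  show nn: "0 \<le> decision_prob q x" for x
    by (cases "(q, x)" rule: decision_prob.cases) (simp_all add: assms(1))
  have fin: "finite (UNIV :: decision set)"
    by (simp add: UNIV_decision)
  have "(\<integral>\<^sup>+x. ennreal (decision_prob q x) \<partial>count_space UNIV)
      = (\<Sum>x\<in>UNIV. ennreal (decision_prob q x))"
    using fin by (simp add: nn_integral_count_space_finite)
  also have "\<dots> = ennreal (\<Sum>x\<in>UNIV. decision_prob q x)"
    by (rule sum_ennreal) (rule nn)
  also have "(\<Sum>x\<in>UNIV. decision_prob q x) = 1"
    using assms(2) by (simp add: UNIV_decision sum_state)
  finally show "(\<integral>\<^sup>+x. ennreal (decision_prob q x) \<partial>count_space UNIV) = 1"
    by simp
qed

lemma pmf_decide_posterior: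
  assumes "\<And>V. 0 \<le> l V" and "(\<Sum>V\<in>UNIV. l V) \<noteq> 0"
  shows "pmf (decide (posterior l)) x = decision_prob (posterior l) x"
proof (rule pmf_decide)
  show "0 \<le> posterior l V" for V
    unfolding posterior_def by (intro divide_nonneg_nonneg sum_nonneg assms(1))
  show "(\<Sum>V\<in>UNIV. posterior l V) = 1"
    using assms(2) by (simp add: posterior_def sum_divide_distrib[symmetric])
qed

definition decision_NL :: "real \<Rightarrow> signal \<times> signal \<Rightarrow> decision pmf" where
  "decision_NL p s = decide (posterior (\<lambda>V. pmf (signals_pmf p V) s))"

definition first_decision :: "real \<Rightarrow> state \<Rightarrow> decision pmf" where
  "first_decision p1 V = bind_pmf (signals_pmf p1 V) (decision_NL p1)"

definition decision_OL :: "real \<Rightarrow> real \<Rightarrow> signal \<times> signal \<Rightarrow> decision \<Rightarrow> decision pmf" where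
  "decision_OL p1 p2 s2 x1 =
     decide (posterior (\<lambda>V. pmf (signals_pmf p2 V) s2 * pmf (first_decision p1 V) x1))"

text \<open>Joint laws of both backers' decisions, given the true state.\<close>
definition decisions_NL :: "state \<Rightarrow> real \<times> real \<Rightarrow> (decision \<times> decision) pmf" where
  "decisions_NL V p =
     bind_pmf (signals_pmf (fst p) V) (\<lambda>s1.
     bind_pmf (decision_NL (fst p) s1) (\<lambda>x1.
     bind_pmf (signals_pmf (snd p) V) (\<lambda>s2.
     bind_pmf (decision_NL (snd p) s2) (\<lambda>x2. return_pmf (x1, x2)))))"

definition decisions_OL :: "state \<Rightarrow> real \<times> real \<Rightarrow> (decision \<times> decision) pmf" where
  "decisions_OL V p =
     bind_pmf (signals_pmf (fst p) V) (\<lambda>s1.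
     bind_pmf (decision_NL (fst p) s1) (\<lambda>x1.
     bind_pmf (signals_pmf (snd p) V) (\<lambda>s2.
     bind_pmf (decision_OL (fst p) (snd p) s2 x1) (\<lambda>x2. return_pmf (x1, x2)))))"

definition pledges :: "project \<Rightarrow> decision \<times> decision \<Rightarrow> real" where
  "pledges i x = of_bool (fst x = Pledge i) + of_bool (snd x = Pledge i)"

definition expected_pledges :: "(decision \<times> decision) pmf \<Rightarrow> project \<Rightarrow> real" where
  "expected_pledges D i = measure_pmf.expectation D (pledges i)"

fun contentedness :: "state \<Rightarrow> (decision \<times> decision) pmf \<Rightarrow> real" where
  "contentedness (True, True) D = expected_pledges D Project1 + expected_pledges D Project2"
| "contentedness (True, False) D = expected_pledges D Project1"
| "contentedness (False, True) D = expected_pledges D Project2"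
| "contentedness (False, False) D =
     2 - (expected_pledges D Project1 + expected_pledges D Project2)"

type_synonym metric = "state \<Rightarrow> real \<times> real \<Rightarrow> real"

definition contentedness_NL :: metric where
  "contentedness_NL V p = contentedness V (decisions_NL V p)"

definition contentedness_OL :: metric where
  "contentedness_OL V p = contentedness V (decisions_OL V p)"

text \<open>Evaluation of observational learning for a metric, given by its value \<open>mO\<close> with and
  its value \<open>mN\<close> without observational learning.\<close>
definition expertness :: "(real \<times> real) set" where
  "expertness = {1/2<..<1} \<times> {1/2<..<1}"

definition improvement_set :: "metric \<Rightarrow> metric \<Rightarrow> state \<Rightarrow> (real \<times> real) set" where
  "improvement_set mO mN V = {p \<in> expertness. mO V p - mN V p \<ge> 0}"

definition harm_set :: "metric \<Rightarrow> metric \<Rightarrow> state \<Rightarrow> (real \<times> real) set" where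
  "harm_set mO mN V = {p \<in> expertness. mO V p - mN V p < 0}"

text \<open>The expertness square is open, and a metric may approach its best improvement only at
  the boundary (contentedness does so as \<open>p\<close> tends to \<open>(1, 1/2)\<close>), so the maximum is read as a
  supremum.\<close>
definition max_improvement :: "metric \<Rightarrow> metric \<Rightarrow> state \<Rightarrow> real" where
  "max_improvement mO mN V = (SUP p\<in>improvement_set mO mN V. mO V p - mN V p)"

definition average_impact :: "metric \<Rightarrow> metric \<Rightarrow> state \<Rightarrow> real" where
  "average_impact mO mN V =
     integral {1/2<..<1} (\<lambda>p1. integral {1/2<..<1} (\<lambda>p2. 2^2 * (mO V (p1, p2) - mN V (p1, p2))))"

end

theory Submission
  imports Defs
begin

text \<open>The likelihood of the first decision is, for each of its three values, a product of a factor
  for each project. Hence the second backer's belief stays a product, and with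
  \<open>n = (2 p1 - 1)\<^sup>2\<close>, \<open>m = (2 p2 - 1)\<^sup>2\<close> the prior odds of a project being low that the second
  backer starts from are \<open>(1 + t) : (1 - t)\<close> with \<open>t\<close> one of \<open>n\<close>, \<open>- n\<close>, \<open>n/3\<close>. Averaging over the
  signals leaves only the denominators \<open>1 - m n\<^sup>2\<close> and \<open>1 - m n\<^sup>2/9\<close>, and the improvement
  is a polynomial in \<open>n\<close>, \<open>e = (1 - m)/2\<close> and the two quantities \<open>f = (1 - m) n\<^sup>2 / (1 - m n\<^sup>2)\<close> and
  \<open>g = (1 - m) (n/3)\<^sup>2 / (1 - m (n/3)\<^sup>2)\<close>. It vanishes at \<open>f = g = 0\<close> and increases in both, which
  gives nonnegativity and, with \<open>f \<le> 1\<close> and \<open>g \<le> 1/9\<close>, the suprema. Replacing \<open>f\<close> and \<open>g\<close> by polynomial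
  bounds gives polynomials that can be integrated term by term.\<close>

section \<open>Beliefs and decisions\<close>

lemma state_cases [case_names TT TF FT FF]:
  fixes V :: state
  obtains "V = (True, True)" | "V = (True, False)" | "V = (False, True)" | "V = (False, False)"
  by (cases V) auto

lemma UNIV_signal: "UNIV = {H, L}"
  using signal.exhaust by auto

lemma pmf_signal:
  assumes "0 < q" "q < 1"
  shows "pmf (signal_pmf q v) H = (if v then q else 1 - q)"
    and "pmf (signal_pmf q v) L = (if v then 1 - q else q)"
proof -
  have inj: "inj (\<lambda>b. if b then H else L)"
    by (auto simp: inj_def)
  show "pmf (signal_pmf q v) H = (if v then q else 1 - q)"
    using pmf_map_inj'[OF inj, of _ True] assms by (simp add: signal_pmf_def)
  show "pmf (signal_pmf q v) L = (if v then 1 - q else q)"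
    using pmf_map_inj'[OF inj, of _ False] assms by (simp add: signal_pmf_def)
qed

lemma pmf_signals: "pmf (signals_pmf q V) s = pmf (signal_pmf q (fst V)) (fst s) * pmf (signal_pmf q (snd V)) (snd s)"
  by (cases s) (simp add: signals_pmf_def pmf_pair)

lemma pmf_bind_finite:
  fixes X :: "'a pmf"
  assumes "finite (UNIV :: 'a set)"
  shows "pmf (bind_pmf X k) y = (\<Sum>x\<in>UNIV. pmf X x * pmf (k x) y)"
proof -
  have "pmf (bind_pmf X k) y = (\<Sum>x\<in>UNIV. pmf (k x) y * pmf X x)"
    unfolding pmf_bind by (rule integral_measure_pmf_real[OF assms UNIV_I])
  then show ?thesis
    by (simp add: mult.commute)
qed

lemma pmf_bind_signals:
  "pmf (bind_pmf (signals_pmf q V) k) x =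
    (\<Sum>s1\<in>UNIV. \<Sum>s2\<in>UNIV. pmf (signal_pmf q (fst V)) s1 * pmf (signal_pmf q (snd V)) s2 * pmf (k (s1, s2)) x)"
proof -
  have "finite (UNIV :: (signal \<times> signal) set)"
    by (simp add: UNIV_signal flip: UNIV_Times_UNIV)
  from pmf_bind_finite[OF this, of "signals_pmf q V" k x] show ?thesis
    by (simp add: sum.cartesian_product' pmf_signals flip: UNIV_Times_UNIV)
qed

section \<open>Product beliefs and their averages over the signals\<close>

definition belief_low :: "(bool \<Rightarrow> real) \<Rightarrow> real" where
  "belief_low a = a False / (a True + a False)"

text \<open>With \<open>x\<close>, \<open>y\<close> the beliefs that the two projects are low,
  splitting the case of two high projects equally gives (1 - x) y + (1 - x)(1 - y)/2 = (1 - x)(1 +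
  y)/2. So every decision probability, and not only that of \<open>No_Pledge\<close>, has one factor
  per project.\<close>

lemma decision_prob_product:
  assumes "a True + a False \<noteq> 0" "b True + b False \<noteq> 0"
  shows "decision_prob (posterior (\<lambda>V. a (fst V) * b (snd V))) No_Pledge = belief_low a * belief_low b"
    and "decision_prob (posterior (\<lambda>V. a (fst V) * b (snd V))) (Pledge Project1) =
      (1 - belief_low a) * (1 + belief_low b) / 2"
    and "decision_prob (posterior (\<lambda>V. a (fst V) * b (snd V))) (Pledge Project2) =
      (1 + belief_low a) * (1 - belief_low b) / 2"
proof -
  have sum: "(\<Sum>V\<in>UNIV. a (fst V) * b (snd V)) = (a True + a False) * (b True + b False)"
    by (simp add: sum_state algebra_simps)
  have high: "1 - belief_low c = c True / (c True + c False)" if "c True + c False \<noteq> 0" for c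
    using that by (simp add: belief_low_def field_simps)
  have post: "posterior (\<lambda>V. a (fst V) * b (snd V)) V =
      (if fst V then 1 - belief_low a else belief_low a) * (if snd V then 1 - belief_low b else belief_low b)" for V
    unfolding high[OF assms(1)] high[OF assms(2)]
    by (cases V) (auto simp: posterior_def sum belief_low_def)
  show "decision_prob (posterior (\<lambda>V. a (fst V) * b (snd V))) No_Pledge = belief_low a * belief_low b"
    and "decision_prob (posterior (\<lambda>V. a (fst V) * b (snd V))) (Pledge Project1) =
      (1 - belief_low a) * (1 + belief_low b) / 2"
    and "decision_prob (posterior (\<lambda>V. a (fst V) * b (snd V))) (Pledge Project2) =
      (1 + belief_low a) * (1 - belief_low b) / 2"
    by (simp_all add: post algebra_simps)
qed

text \<open>Mean belief that a project is low, held by a backer of expertness \<open>q\<close> with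
  unnormalised prior weights \<open>a\<close>, when the true quality is \<open>v\<close>.\<close>

definition expected_low :: "(bool \<Rightarrow> real) \<Rightarrow> real \<Rightarrow> bool \<Rightarrow> real" where
  "expected_low a q v =
    (\<Sum>s\<in>UNIV. pmf (signal_pmf q v) s * belief_low (\<lambda>v'. pmf (signal_pmf q v') s * a v'))"

text \<open>Independence: a weight that is a product over the two projects stays one after the
  signals, so the projects can be averaged separately.\<close>
lemma pmf_decide_signals:
  fixes a b :: "bool \<Rightarrow> real"
  assumes q: "0 < q" "q < 1" and a: "\<And>v. 0 < a v" and b: "\<And>v. 0 < b v"
  defines "D \<equiv> \<lambda>V. bind_pmf (signals_pmf q V)
    (\<lambda>s. decide (posterior (\<lambda>V. pmf (signals_pmf q V) s * (a (fst V) * b (snd V)))))"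
  shows "pmf (D V) No_Pledge = expected_low a q (fst V) * expected_low b q (snd V)"
    and "pmf (D V) (Pledge Project1) =
      (1 - expected_low a q (fst V)) * (1 + expected_low b q (snd V)) / 2"
    and "pmf (D V) (Pledge Project2) =
      (1 + expected_low a q (fst V)) * (1 - expected_low b q (snd V)) / 2"
proof -
  define c where "c s v = pmf (signal_pmf q v) s * a v" for s v
  define d where "d s v = pmf (signal_pmf q v) s * b v" for s v
  have pos: "0 < pmf (signal_pmf q v) s" for v s
    using q by (cases s) (auto simp: pmf_signal)
  have c: "0 < c s v" and d: "0 < d s v" for s v
    unfolding c_def d_def using a b pos by simp_all
  have nz: "c s True + c s False \<noteq> 0" "d s True + d s False \<noteq> 0" for s
    using c[of s True] c[of s False] d[of s True] d[of s False] by linarith+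
  have weight: "(\<lambda>V. pmf (signals_pmf q V) s * (a (fst V) * b (snd V)))
      = (\<lambda>V. c (fst s) (fst V) * d (snd s) (snd V))" for s
    by (simp add: c_def d_def pmf_signals mult_ac)
  have D: "pmf (decide (posterior (\<lambda>V. c s1 (fst V) * d s2 (snd V)))) x =
      decision_prob (posterior (\<lambda>V. c s1 (fst V) * d s2 (snd V))) x" for s1 s2 x
  proof (rule pmf_decide_posterior)
    have "0 < c s1 (fst V) * d s2 (snd V)" for V
      using c d by simp
    then show "0 \<le> c s1 (fst V) * d s2 (snd V)" "(\<Sum>V\<in>UNIV. c s1 (fst V) * d s2 (snd V)) \<noteq> 0" for V
      by (auto simp: less_imp_le sum_state add_pos_pos c d less_imp_neq[THEN not_sym])
  qed
  note prod = decision_prob_product[where a = "c s1" and b = "d s2" for s1 s2, OF nz]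
  have one: "(\<Sum>s\<in>UNIV. pmf (signal_pmf q v) s) = 1" for v
    using q by (simp add: UNIV_signal pmf_signal)
  have low: "expected_low a q v = (\<Sum>s\<in>UNIV. pmf (signal_pmf q v) s * belief_low (c s))"
    "expected_low b q v = (\<Sum>s\<in>UNIV. pmf (signal_pmf q v) s * belief_low (d s))" for v
    by (simp_all add: expected_low_def c_def[abs_def] d_def[abs_def])
  \<comment> \<open>The signal probabilities sum to 1, so \<open>1 +\<close> and \<open>1 -\<close>
    move inside the averages. The claims then equate products of two sums with the double sum over
    both signals.\<close>
  have compl: "1 + expected_low a q v = (\<Sum>s\<in>UNIV. pmf (signal_pmf q v) s * (1 + belief_low (c s)))"
    "1 - expected_low a q v = (\<Sum>s\<in>UNIV. pmf (signal_pmf q v) s * (1 - belief_low (c s)))"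
    "1 + expected_low b q v = (\<Sum>s\<in>UNIV. pmf (signal_pmf q v) s * (1 + belief_low (d s)))"
    "1 - expected_low b q v = (\<Sum>s\<in>UNIV. pmf (signal_pmf q v) s * (1 - belief_low (d s)))" for v
    by (simp_all add: low one distrib_left right_diff_distrib sum.distrib sum_subtractf)
  show "pmf (D V) No_Pledge = expected_low a q (fst V) * expected_low b q (snd V)"
    "pmf (D V) (Pledge Project1) =
      (1 - expected_low a q (fst V)) * (1 + expected_low b q (snd V)) / 2"
    "pmf (D V) (Pledge Project2) =
      (1 + expected_low a q (fst V)) * (1 - expected_low b q (snd V)) / 2"
    unfolding D_def pmf_bind_signals weight fst_conv snd_conv D prod compl
    unfolding low sum_product sum_divide_distrib
    by (simp_all add: mult_ac)
qed

text \<open>Only the odds of \<open>a\<close> count, so the scale \<open>s\<close> is free. The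
  total weights of the signals H and L are \<open>s * B\<close> and \<open>s * A\<close>; both
  signals together leave the denominator \<open>A * B\<close>, which is even in \<open>t\<close>.
  The factor \<open>(1 - m) / 2\<close> is 2 q (1 - q).\<close>

lemma expected_low_closed:
  fixes q s t :: real and a :: "bool \<Rightarrow> real"
  assumes q: "0 < q" "q < 1" and s: "0 < s" and t: "\<bar>t\<bar> < 1"
    and a: "a False = s * (1 + t)" "a True = s * (1 - t)"
  defines "m \<equiv> (2 * q - 1)\<^sup>2"
  shows "expected_low a q False = 1 - (1 - m) / 2 * (1 - t) / (1 - m * t\<^sup>2)"
    and "expected_low a q True = (1 - m) / 2 * (1 + t) / (1 - m * t\<^sup>2)"
proof -
  define A where "A = 1 + (2 * q - 1) * t"
  define B where "B = 1 - (2 * q - 1) * t"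
  have "\<bar>(2 * q - 1) * t\<bar> < 1"
    using q t abs_mult_less[of "2 * q - 1" 1 t 1] by (simp add: abs_mult abs_less_iff)
  then have AB: "A > 0" "B > 0"
    by (auto simp: A_def B_def)
  have den: "1 - m * t\<^sup>2 = A * B"
    by (simp add: A_def B_def m_def power2_eq_square algebra_simps)
  have low: "belief_low (\<lambda>v'. pmf (signal_pmf q v') H * a v') = (1 - q) * (1 + t) / B"
    "belief_low (\<lambda>v'. pmf (signal_pmf q v') L * a v') = q * (1 + t) / A"
  proof -
    have "q * a True + (1 - q) * a False = s * B" "(1 - q) * a True + q * a False = s * A"
      by (simp_all add: a A_def B_def algebra_simps)
    then show "belief_low (\<lambda>v'. pmf (signal_pmf q v') H * a v') = (1 - q) * (1 + t) / B"
      "belief_low (\<lambda>v'. pmf (signal_pmf q v') L * a v') = q * (1 + t) / A"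
      using s AB q by (simp_all add: belief_low_def pmf_signal a)
  qed
  have sum: "expected_low a q v = pmf (signal_pmf q v) H * belief_low (\<lambda>v'. pmf (signal_pmf q v') H * a v')
      + pmf (signal_pmf q v) L * belief_low (\<lambda>v'. pmf (signal_pmf q v') L * a v')" for v
    by (simp add: expected_low_def UNIV_signal)
  show "expected_low a q False = 1 - (1 - m) / 2 * (1 - t) / (1 - m * t\<^sup>2)"
    "expected_low a q True = (1 - m) / 2 * (1 + t) / (1 - m * t\<^sup>2)"
    unfolding den sum low unfolding pmf_signal[OF q] if_True if_False
    using AB by (simp_all add: field_simps)
      (simp_all add: A_def B_def m_def power2_eq_square algebra_simps)
qed

section \<open>Reduction of contentedness to single decisions\<close>

lemma expected_pledges_eq:
  "expected_pledges D i = pmf (map_pmf fst D) (Pledge i) + pmf (map_pmf snd D) (Pledge i)"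
proof -
  have *: "pmf (map_pmf h D) y = measure_pmf.expectation D (\<lambda>x. of_bool (h x = y))"
    for h :: "decision \<times> decision \<Rightarrow> decision" and y
  proof -
    have "(\<lambda>x. of_bool (h x = y)) = (indicator (h -` {y}) :: _ \<Rightarrow> real)"
      by (auto simp: indicator_def)
    then show ?thesis
      by (simp add: pmf_map)
  qed
  have i: "integrable (measure_pmf D) (\<lambda>x. of_bool (h x = y) :: real)"
    for h :: "decision \<times> decision \<Rightarrow> decision" and y
    by (rule measure_pmf.integrable_const_bound[where B = 1]) auto
  show ?thesis
    unfolding expected_pledges_def pledges_def * by (rule Bochner_Integration.integral_add[OF i i])
qed

text \<open>Share of one backer in contentedness; in state (False, False) the constant 2 splits into
  1 per backer.\<close>

fun success :: "state \<Rightarrow> decision pmf \<Rightarrow> real" where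
  "success (True, True) X = pmf X (Pledge Project1) + pmf X (Pledge Project2)"
| "success (True, False) X = pmf X (Pledge Project1)"
| "success (False, True) X = pmf X (Pledge Project2)"
| "success (False, False) X = 1 - (pmf X (Pledge Project1) + pmf X (Pledge Project2))"

lemma contentedness_eq: "contentedness V D = success V (map_pmf fst D) + success V (map_pmf snd D)"
  by (cases V rule: state_cases) (simp_all add: expected_pledges_eq)

lemma map_decisions_NL:
  "map_pmf fst (decisions_NL V p) = first_decision (fst p) V"
  "map_pmf snd (decisions_NL V p) = first_decision (snd p) V"
  by (simp_all add: decisions_NL_def first_decision_def map_bind_pmf bind_return_pmf')

definition second_decision :: "state \<Rightarrow> real \<times> real \<Rightarrow> decision \<Rightarrow> decision pmf" where
  "second_decision V p x1 = bind_pmf (signals_pmf (snd p) V) (\<lambda>s2. decision_OL (fst p) (snd p) s2 x1)"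

lemma map_decisions_OL:
  "map_pmf fst (decisions_OL V p) = first_decision (fst p) V"
  "map_pmf snd (decisions_OL V p) = bind_pmf (first_decision (fst p) V) (second_decision V p)"
  by (simp_all add: decisions_OL_def first_decision_def second_decision_def[abs_def]
      map_bind_pmf bind_return_pmf' bind_assoc_pmf)

text \<open>The first backer decides by the same law with and without observational learning, so
  that share cancels.\<close>

lemma contentedness_diff:
  "contentedness_OL V p - contentedness_NL V p =
    success V (bind_pmf (first_decision (fst p) V) (second_decision V p)) - success V (first_decision (snd p) V)"
  by (simp add: contentedness_OL_def contentedness_NL_def contentedness_eq map_decisions_NL map_decisions_OL)

section \<open>Closed form of the improvement\<close>

lemma pmf_bind_decision:
  fixes X :: "decision pmf"
  shows "pmf (bind_pmf X k) y = pmf X No_Pledge * pmf (k No_Pledge) y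
    + pmf X (Pledge Project1) * pmf (k (Pledge Project1)) y
    + pmf X (Pledge Project2) * pmf (k (Pledge Project2)) y"
  by (subst pmf_bind_finite) (simp_all add: UNIV_decision)

text \<open>The uniform prior is the case \<open>t = 0\<close> of
  \<open>expected_low_closed\<close>. As functions of \<open>V\<close>, the resulting products are
  the likelihoods that the second backer uses.\<close>

lemma pmf_first_decision:
  fixes q :: real
  assumes q: "0 < q" "q < 1"
  defines "l \<equiv> \<lambda>v. (if v then 1 - (2 * q - 1)\<^sup>2 else 1 + (2 * q - 1)\<^sup>2) / 2"
  shows "pmf (first_decision q V) No_Pledge = l (fst V) * l (snd V)"
    and "pmf (first_decision q V) (Pledge Project1) = (1 - l (fst V)) * (1 + l (snd V)) / 2"
    and "pmf (first_decision q V) (Pledge Project2) = (1 + l (fst V)) * (1 - l (snd V)) / 2"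
proof -
  have "expected_low (\<lambda>v. 1) q v = l v" for v
    using expected_low_closed[of q 1 0 "\<lambda>v. 1"] q by (cases v) (simp_all add: l_def field_simps)
  then show "pmf (first_decision q V) No_Pledge = l (fst V) * l (snd V)"
    "pmf (first_decision q V) (Pledge Project1) = (1 - l (fst V)) * (1 + l (snd V)) / 2"
    "pmf (first_decision q V) (Pledge Project2) = (1 + l (fst V)) * (1 - l (snd V)) / 2"
    using pmf_decide_signals[of q "\<lambda>v. 1" "\<lambda>v. 1" V] q
    by (simp_all add: first_decision_def decision_NL_def[abs_def])
qed

text \<open>Relative reduction of the expected posterior variance of a project's quality when the
  prior odds are (1 + t) : (1 - t) instead of even: the variance is (1 - m)/4 for even odds and (1 -
  m)/4 * (1 - \<open>learn m t\<close>) for these.\<close>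

definition learn :: "real \<Rightarrow> real \<Rightarrow> real" where
  "learn m t = (1 - m) * t\<^sup>2 / (1 - m * t\<^sup>2)"

text \<open>\<open>f\<close> and \<open>g\<close> are free arguments, not tied to \<open>m\<close>
  and \<open>n\<close>, so that bounds can be put in place of \<open>learn m n\<close> and
  \<open>learn m (n / 3)\<close>.\<close>

fun gain :: "state \<Rightarrow> real \<Rightarrow> real \<Rightarrow> real \<Rightarrow> real \<Rightarrow> real" where
  "gain (True, True) n e f g = e\<^sup>2 / 4 * (5 * f + 3 * g - f\<^sup>2 - 3 * f * g)"
| "gain (False, False) n e f g =
    e / 4 * ((5 + 3 * n - 5 * e) * f + e * f\<^sup>2 + 3 * (1 - n - e * (1 - f)) * g)"
| "gain _ n e f g =
    e / 16 * ((15 + 3 * n - 10 * e) * f + 2 * e * f\<^sup>2 + (9 - 3 * n - 6 * e * (1 - f)) * g)"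

lemma contentedness_gain:
  assumes "(p1, p2) \<in> expertness"
  defines "n \<equiv> (2 * p1 - 1)\<^sup>2" and "m \<equiv> (2 * p2 - 1)\<^sup>2"
  shows "contentedness_OL V (p1, p2) - contentedness_NL V (p1, p2) =
    gain V n ((1 - m) / 2) (learn m n) (learn m (n / 3))"
proof -
  have p: "0 < p1" "p1 < 1" "0 < p2" "p2 < 1" "1/2 < p1" "1/2 < p2"
    using assms(1) by (auto simp: expertness_def)
  have n: "0 < n" "n < 1" and m: "0 < m" "m < 1"
    using p by (auto simp: n_def m_def power_less_one_iff abs_square_less_1)
  define e where "e = (1 - m) / 2"
  define R where "R t = 1 / (1 - m * t\<^sup>2)" for t
  define l where "l v = (if v then 1 - n else 1 + n) / 2" for v
  have l: "0 < l v" "0 < 1 - l v" "0 < 1 + l v" for v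
    using n by (auto simp: l_def field_simps)
  have first1: "pmf (first_decision p1 V) No_Pledge = l (fst V) * l (snd V)"
    "pmf (first_decision p1 V) (Pledge Project1) = (1 - l (fst V)) * (1 + l (snd V)) / 2"
    "pmf (first_decision p1 V) (Pledge Project2) = (1 + l (fst V)) * (1 - l (snd V)) / 2" for V
    using pmf_first_decision[of p1 V] p by (simp_all add: l_def n_def)
  define k where "k v = (if v then e else 1 - e)" for v
  have first2: "pmf (first_decision p2 V) No_Pledge = k (fst V) * k (snd V)"
    "pmf (first_decision p2 V) (Pledge Project1) = (1 - k (fst V)) * (1 + k (snd V)) / 2"
    "pmf (first_decision p2 V) (Pledge Project2) = (1 + k (fst V)) * (1 - k (snd V)) / 2" for V
  proof -
    have k: "k v = (if v then 1 - m else 1 + m) / 2" for v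
      by (simp add: k_def e_def field_simps)
    show "pmf (first_decision p2 V) No_Pledge = k (fst V) * k (snd V)"
      "pmf (first_decision p2 V) (Pledge Project1) = (1 - k (fst V)) * (1 + k (snd V)) / 2"
      "pmf (first_decision p2 V) (Pledge Project2) = (1 + k (fst V)) * (1 - k (snd V)) / 2"
      unfolding k m_def using pmf_first_decision[of p2 V] p by blast+
  qed
  have low: "expected_low a p2 v = (if v then e * (1 + t) * R t else 1 - e * (1 - t) * R t)"
    if "0 < s" "\<bar>t\<bar> < 1" "a False = s * (1 + t)" "a True = s * (1 - t)" for a s t v
    using expected_low_closed[of p2 s t a] p that by (simp add: e_def R_def m_def)
  have Rm: "R (- t) = R t" for t
    by (simp add: R_def)
  \<comment> \<open>The weights \<open>l\<close>, \<open>1 - l\<close> and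
    \<open>(1 + l) / 2\<close> have low-to-high odds given by \<open>t = n\<close>,
    \<open>- n\<close> and \<open>n / 3\<close>, with scales 1/2, 1/2 and 3/4.\<close>
  have lows: "expected_low l p2 v = (if v then e * (1 + n) * R n else 1 - e * (1 - n) * R n)"
    "expected_low (\<lambda>v. 1 - l v) p2 v = (if v then e * (1 - n) * R n else 1 - e * (1 + n) * R n)"
    "expected_low (\<lambda>v. (1 + l v) / 2) p2 v = (if v then e * (1 + n / 3) * R (n / 3) else 1 - e * (1 - n / 3) * R (n / 3))"
    for v
    using low[of "1/2" n l] low[of "1/2" "- n" "\<lambda>v. 1 - l v"] low[of "3/4" "n / 3" "\<lambda>v. (1 + l v) / 2"] n
    by (simp_all add: l_def Rm field_simps)
  have second: "second_decision V (p1, p2) x = bind_pmf (signals_pmf p2 V)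
      (\<lambda>s. decide (posterior (\<lambda>V. pmf (signals_pmf p2 V) s * pmf (first_decision p1 V) x)))" for V x
    by (simp add: second_decision_def decision_OL_def)
  \<comment> \<open>The factor 1/2 in the likelihood of a pledge is attached to
    \<open>1 + l\<close>, which brings each likelihood into the form required by
    \<open>pmf_decide_signals\<close>.\<close>
  have seconds:
    "second_decision V (p1, p2) No_Pledge = bind_pmf (signals_pmf p2 V)
      (\<lambda>s. decide (posterior (\<lambda>V. pmf (signals_pmf p2 V) s * (l (fst V) * l (snd V)))))"
    "second_decision V (p1, p2) (Pledge Project1) = bind_pmf (signals_pmf p2 V)
      (\<lambda>s. decide (posterior (\<lambda>V. pmf (signals_pmf p2 V) s * ((1 - l (fst V)) * ((1 + l (snd V)) / 2)))))"
    "second_decision V (p1, p2) (Pledge Project2) = bind_pmf (signals_pmf p2 V)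
      (\<lambda>s. decide (posterior (\<lambda>V. pmf (signals_pmf p2 V) s * ((1 + l (fst V)) / 2 * (1 - l (snd V))))))" for V
    by (simp_all add: second first1)
  have l': "0 < (1 + l v) / 2" for v
    using l by simp
  note second_pmf = pmf_decide_signals[of p2 l l, folded seconds, OF p(3,4) l(1) l(1)]
    pmf_decide_signals[of p2 "\<lambda>v. 1 - l v" "\<lambda>v. (1 + l v) / 2", folded seconds, OF p(3,4) l(2) l']
    pmf_decide_signals[of p2 "\<lambda>v. (1 + l v) / 2" "\<lambda>v. 1 - l v", folded seconds, OF p(3,4) l' l(2)]
  have f: "learn m n = 1 - (1 - n\<^sup>2) * R n" "learn m (n / 3) = 1 - (1 - n\<^sup>2 / 9) * R (n / 3)"
  proof -
    have "learn m t = 1 - (1 - t\<^sup>2) * R t" if "m * t\<^sup>2 \<noteq> 1" for t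
      using that by (simp add: learn_def R_def field_simps)
    moreover have "m * n\<^sup>2 < 1"
      using n m mult_strict_mono[of m 1 "n\<^sup>2" 1] by (simp add: power_less_one_iff)
    moreover from this have "m * (n / 3)\<^sup>2 < 1"
      by (simp add: power_divide)
    ultimately show "learn m n = 1 - (1 - n\<^sup>2) * R n" "learn m (n / 3) = 1 - (1 - n\<^sup>2 / 9) * R (n / 3)"
      by (auto simp: power_divide)
  qed
  have "success V (bind_pmf (first_decision p1 V) (second_decision V (p1, p2))) - success V (first_decision p2 V)
      = gain V n e (learn m n) (learn m (n / 3))"
    \<comment> \<open>With \<open>learn\<close> written through \<open>R\<close>, the claim is a
      polynomial identity in \<open>n\<close>, \<open>e\<close>, \<open>R n\<close> and
      \<open>R (n / 3)\<close>; \<open>R\<close> stays unevaluated.\<close>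
    unfolding f
    by (cases V rule: state_cases;
        simp add: pmf_bind_decision second_pmf first1 first2 lows;
        simp add: l_def k_def; simp add: power2_eq_square field_simps)
  then show ?thesis
    by (simp add: contentedness_diff e_def)
qed

section \<open>Monotonicity of the improvement\<close>

text \<open>Move \<open>f\<close> to \<open>f'\<close> at the old \<open>g\<close>, then
  \<open>g\<close> to \<open>g'\<close> at \<open>f'\<close>. The difference splits into two terms,
  each an increment times a nonnegative coefficient. Assumption \<open>ne\<close> is the sign of the
  coefficient of \<open>g' - g\<close> in state (False, False).\<close>

lemma gain_mono:
  assumes n: "0 \<le> n" "n \<le> 1" and e: "0 \<le> e" "e \<le> 1/2"
    and f: "0 \<le> f" "f \<le> f'" "f' \<le> 1" and g: "0 \<le> g" "g \<le> g'" "g' \<le> 1"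
    and ne: "n + e * (1 - f') \<le> 1"
  shows "gain V n e f g \<le> gain V n e f' g'"
proof -
  have ef: "0 \<le> e * (1 - f')" "e * (1 - f') \<le> e"
    using e f by (simp_all add: mult_left_le)
  have "0 \<le> e * (f + f' + 3 * g)"
    using e f g by simp
  then have c00: "0 \<le> 5 + 3 * n - 5 * e + e * (f + f' + 3 * g)"
    using n e by linarith
  have "0 \<le> e * (2 * (f + f') + 6 * g)"
    using e f g by simp
  then have c10: "0 \<le> 15 + 3 * n - 10 * e + e * (2 * (f + f') + 6 * g)"
    using n e by linarith
  show ?thesis
  proof (cases V rule: state_cases)
    case FF
    have "gain V n e f' g' - gain V n e f g =
        e / 4 * ((5 + 3 * n - 5 * e + e * (f + f' + 3 * g)) * (f' - f) + 3 * (1 - n - e * (1 - f')) * (g' - g))"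
      by (simp add: FF power2_eq_square algebra_simps)
    also have "\<dots> \<ge> 0"
      using c00 e f g ne by (intro mult_nonneg_nonneg[OF _ add_nonneg_nonneg[OF mult_nonneg_nonneg mult_nonneg_nonneg]]) auto
    finally show ?thesis by simp
  next
    case TT
    have "gain V n e f' g' - gain V n e f g = e\<^sup>2 / 4 * ((5 - f - f' - 3 * g) * (f' - f) + 3 * (1 - f') * (g' - g))"
      by (simp add: TT power2_eq_square algebra_simps)
    also have "\<dots> \<ge> 0"
      using f g by (intro mult_nonneg_nonneg[OF _ add_nonneg_nonneg[OF mult_nonneg_nonneg mult_nonneg_nonneg]]) auto
    finally show ?thesis by simp
  next
    case TF
    have "gain V n e f' g' - gain V n e f g =
        e / 16 * ((15 + 3 * n - 10 * e + e * (2 * (f + f') + 6 * g)) * (f' - f) + (9 - 3 * n - 6 * (e * (1 - f'))) * (g' - g))"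
      by (simp add: TF power2_eq_square algebra_simps)
    also have "\<dots> \<ge> 0"
      using c10 n e f g ef by (intro mult_nonneg_nonneg[OF _ add_nonneg_nonneg[OF mult_nonneg_nonneg mult_nonneg_nonneg]]) auto
    finally show ?thesis by simp
  next
    case FT
    have "gain V n e f' g' - gain V n e f g =
        e / 16 * ((15 + 3 * n - 10 * e + e * (2 * (f + f') + 6 * g)) * (f' - f) + (9 - 3 * n - 6 * (e * (1 - f'))) * (g' - g))"
      by (simp add: FT power2_eq_square algebra_simps)
    also have "\<dots> \<ge> 0"
      using c10 n e f g ef by (intro mult_nonneg_nonneg[OF _ add_nonneg_nonneg[OF mult_nonneg_nonneg mult_nonneg_nonneg]]) auto
    finally show ?thesis by simp
  qed
qed

text \<open>With y = t^2, \<open>learn m t\<close> is the geometric series of (1 - m) y / (1 - m y);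
  its first one or two terms give the lower bounds. For fixed \<open>t\<close> it is concave in
  \<open>m\<close>; the third bound is its tangent at m = 0 and the fourth its value there.\<close>

lemma learn_bounds:
  assumes m: "0 < m" "m < 1" and t: "0 < t" "t < 1"
  shows "(1 - m) * t\<^sup>2 \<le> learn m t"
    and "(1 - m) * t\<^sup>2 * (1 + m * t\<^sup>2) \<le> learn m t"
    and "learn m t \<le> (1 - m) * t\<^sup>2 + m * t ^ 4"
    and "learn m t \<le> t\<^sup>2"
proof -
  define y where "y = t\<^sup>2"
  define x where "x = m * y"
  have y: "0 < y" "y < 1"
    using t by (auto simp: y_def power_less_one_iff)
  have x: "0 < x" "x < y" "x < m"
    using m y by (auto simp: x_def)
  have l: "learn m t = (1 - m) * y / (1 - x)"
    by (simp add: learn_def y_def x_def)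
  have my: "(1 - m) * y > 0"
    using m y by simp
  have "(1 + x) * (1 - x) \<le> 1"
    by (simp add: algebra_simps)
  then have "(1 - m) * y * ((1 + x) * (1 - x)) \<le> (1 - m) * y * 1"
    using my by (intro mult_left_mono) auto
  then have 2: "(1 - m) * y * (1 + x) \<le> learn m t"
    using x m y by (simp add: l le_divide_eq mult.assoc)
  then show "(1 - m) * t\<^sup>2 * (1 + m * t\<^sup>2) \<le> learn m t"
    by (simp add: y_def x_def)
  show "(1 - m) * t\<^sup>2 \<le> learn m t"
    using 2 mult_left_mono[of 1 "1 + x" "(1 - m) * y"] my x by (simp add: y_def)
  have "(1 - m) * y \<le> ((1 - m) * y + m * y\<^sup>2) * (1 - x)"
  proof -
    have "((1 - m) * y + m * y\<^sup>2) * (1 - x) - (1 - m) * y = x * (m * y * (1 - y))"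
      by (simp add: x_def power2_eq_square algebra_simps)
    also have "\<dots> \<ge> 0"
      using x m y by simp
    finally show ?thesis by simp
  qed
  then have 3: "learn m t \<le> (1 - m) * y + m * y\<^sup>2"
    using x m y by (simp add: l divide_le_eq)
  then show "learn m t \<le> (1 - m) * t\<^sup>2 + m * t ^ 4"
    by (simp add: y_def power_mult[symmetric])
  have "m * y\<^sup>2 \<le> m * y"
    using m y by (simp add: power2_eq_square)
  then show "learn m t \<le> t\<^sup>2"
    using 3 by (simp add: y_def algebra_simps)
qed

lemma learn_nonneg: "0 < m \<Longrightarrow> m < 1 \<Longrightarrow> 0 < t \<Longrightarrow> t < 1 \<Longrightarrow> 0 \<le> learn m t"
  by (rule order_trans[OF _ learn_bounds(1)]) simp_all

lemma learn_le_1: "0 < m \<Longrightarrow> m < 1 \<Longrightarrow> 0 < t \<Longrightarrow> t < 1 \<Longrightarrow> learn m t \<le> 1"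
  by (rule order_trans[OF learn_bounds(4)]) (simp_all add: power_le_one)

text \<open>Supplies assumption \<open>ne\<close> of \<open>gain_mono\<close>. Since 1 -
  \<open>learn m n\<close> = (1 - n^2) / (1 - m n^2), clearing the denominator leaves 1 - n times a
  sum of nonnegative terms.\<close>

lemma learn_complement:
  assumes m: "0 < m" "m < 1" and n: "0 < n" "n < 1"
  shows "n + (1 - m) / 2 * (1 - learn m n) \<le> 1"
proof -
  have "m * n\<^sup>2 < 1"
    using m n mult_strict_mono[of m 1 "n\<^sup>2" 1] by (simp add: power_less_one_iff)
  then have d: "0 < 1 - m * n\<^sup>2" by simp
  have "(1 - n - (1 - m) / 2 * (1 - learn m n)) * (1 - m * n\<^sup>2) = (1 - n) * ((1 - n) * (1 - m) / 2 + m * (1 - n\<^sup>2)) "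
    using d by (simp add: learn_def field_simps) (simp add: power2_eq_square power4_eq_xxxx algebra_simps)
  also have "\<dots> \<ge> 0"
    using m n by (intro mult_nonneg_nonneg add_nonneg_nonneg) (auto simp: power_le_one)
  finally show ?thesis
    using d by (simp add: zero_le_mult_iff)
qed

context
  fixes m n :: real
  assumes m: "0 < m" "m < 1" and n: "0 < n" "n < 1"
begin

lemma gain_learn_ge:
  assumes "0 \<le> f" "f \<le> learn m n" "0 \<le> g" "g \<le> learn m (n / 3)"
  shows "gain V n ((1 - m) / 2) f g \<le> gain V n ((1 - m) / 2) (learn m n) (learn m (n / 3))"
  using assms m n learn_le_1[of m n] learn_le_1[of m "n / 3"] learn_complement[OF m n]
  by (intro gain_mono) auto

lemma gain_learn_le:
  assumes "learn m n \<le> f" "f \<le> 1" "n\<^sup>2 / 9 \<le> g" "g \<le> 1"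
  shows "gain V n ((1 - m) / 2) (learn m n) (learn m (n / 3)) \<le> gain V n ((1 - m) / 2) f g"
proof (rule gain_mono)
  show "learn m (n / 3) \<le> g"
    using learn_bounds(4)[of m "n / 3"] m n assms by (simp add: power_divide)
  \<comment> \<open>Raising \<open>f\<close> above \<open>learn m n\<close> only relaxes the
    inequality of \<open>learn_complement\<close>.\<close>
  have "(1 - m) / 2 * (1 - f) \<le> (1 - m) / 2 * (1 - learn m n)"
    using m assms by (intro mult_left_mono) auto
  then show "n + (1 - m) / 2 * (1 - f) \<le> 1"
    using learn_complement[OF m n] by linarith
qed (use assms m n learn_nonneg in auto)

lemma gain_nonneg: "0 \<le> gain V n ((1 - m) / 2) (learn m n) (learn m (n / 3))"
proof -
  have "gain V n ((1 - m) / 2) 0 0 = 0"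
    by (cases V rule: state_cases) simp_all
  then show ?thesis
    using gain_learn_ge[of 0 0 V] learn_nonneg[of m n] learn_nonneg[of m "n / 3"] m n by simp
qed

lemma gain_le:
  shows "gain (False, False) n ((1 - m) / 2) (learn m n) (learn m (n / 3)) \<le> 3 / 4"
    and "gain (True, False) n ((1 - m) / 2) (learn m n) (learn m (n / 3)) \<le> 11 / 24"
    and "gain (False, True) n ((1 - m) / 2) (learn m n) (learn m (n / 3)) \<le> 11 / 24"
    and "gain (True, True) n ((1 - m) / 2) (learn m n) (learn m (n / 3)) \<le> 1 / 4"
proof -
  have sq: "n\<^sup>2 \<le> 1"
    using n by (simp add: power_le_one)
  have f1: "learn m n \<le> 1"
    using learn_le_1 m n by simp
  have m2: "0 \<le> m * m" "m * m \<le> m" "m * n \<ge> 0"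
    using m n by auto
  \<comment> \<open>With e = (1 - m)/2, the values at f = g = 1 are e (2 - e) in (False, False) and
    e^2 in (True, True). In the mixed states g = 1 would be too coarse; f = 1, g = 1/9 gives e (1 +
    n/6 - e/2). The bounds are the values at e = 1/2, n = 1.\<close>
  have "gain V n ((1 - m) / 2) (learn m n) (learn m (n / 3)) \<le> gain V n ((1 - m) / 2) 1 1"
    "gain V n ((1 - m) / 2) (learn m n) (learn m (n / 3)) \<le> gain V n ((1 - m) / 2) 1 (1 / 9)" for V
    using sq f1 by (intro gain_learn_le; simp)+
  moreover have "gain (False, False) n ((1 - m) / 2) 1 1 \<le> 3 / 4"
    by (simp add: power2_eq_square field_simps) (use m n m2 in linarith)
  moreover have "gain (True, False) n ((1 - m) / 2) 1 (1 / 9) \<le> 11 / 24"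
    by (simp add: power2_eq_square field_simps) (use m n m2 in linarith)
  moreover have "gain (False, True) n ((1 - m) / 2) 1 (1 / 9) \<le> 11 / 24"
    by (simp add: power2_eq_square field_simps) (use m n m2 in linarith)
  moreover have "gain (True, True) n ((1 - m) / 2) 1 1 \<le> 1 / 4"
    by (simp add: power2_eq_square field_simps) (use m n m2 in linarith)
  ultimately show "gain (False, False) n ((1 - m) / 2) (learn m n) (learn m (n / 3)) \<le> 3 / 4"
    "gain (True, False) n ((1 - m) / 2) (learn m n) (learn m (n / 3)) \<le> 11 / 24"
    "gain (False, True) n ((1 - m) / 2) (learn m n) (learn m (n / 3)) \<le> 11 / 24"
    "gain (True, True) n ((1 - m) / 2) (learn m n) (learn m (n / 3)) \<le> 1 / 4"
    by (blast intro: order_trans)+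
qed

end

section \<open>Integration of polynomial bounds\<close>

lemma set_integrable_bounded_interval:
  fixes f :: "real \<Rightarrow> real"
  assumes "f \<in> borel_measurable borel" and "\<And>x. x \<in> {a<..<b} \<Longrightarrow> \<bar>f x\<bar> \<le> B"
  shows "set_integrable lborel {a<..<b} f"
  unfolding set_integrable_def
proof (rule integrableI_bounded_set_indicator[where B = B])
  show "emeasure lborel {a<..<b} < \<infinity>"
    by (cases "a \<le> b") auto
qed (use assms in auto)

text \<open>Comparing the outer integrals requires the inner integral to be integrable in
  \<open>x\<close>. This comes from Lebesgue integration: a parameter integral of a jointly
  measurable function is measurable, and here it is bounded by \<open>B * (b - a)\<close>.\<close>

lemma
  fixes F P :: "real \<Rightarrow> real \<Rightarrow> real" and a b :: real
  defines "S \<equiv> {a<..<b}"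
  assumes F: "(\<lambda>(x, y). F x y) \<in> borel_measurable (borel \<Otimes>\<^sub>M borel)"
    and B: "\<And>x y. x \<in> S \<Longrightarrow> y \<in> S \<Longrightarrow> \<bar>F x y\<bar> \<le> B"
    and P: "\<And>x. (P x has_integral p x) S" "(p has_integral r) S"
  shows iterated_integral_ge:
      "(\<And>x y. x \<in> S \<Longrightarrow> y \<in> S \<Longrightarrow> P x y \<le> F x y) \<Longrightarrow> r \<le> integral S (\<lambda>x. integral S (F x))"
    and iterated_integral_le:
      "(\<And>x y. x \<in> S \<Longrightarrow> y \<in> S \<Longrightarrow> F x y \<le> P x y) \<Longrightarrow> integral S (\<lambda>x. integral S (F x)) \<le> r"
proof -
  have Fx: "F x \<in> borel_measurable borel" for x
    using measurable_compose[OF measurable_Pair1'[of x borel borel] F] by simp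
  have int: "set_integrable lborel S (F x)" if "x \<in> S" for x
    unfolding S_def using Fx B[OF that] by (intro set_integrable_bounded_interval) (auto simp: S_def)
  define I where "I x = (LINT y:S|lborel. F x y)" for x
  have I: "integral S (F x) = I x" "F x integrable_on S" if "x \<in> S" for x
    using set_borel_integral_eq_integral[OF int[OF that]] by (simp_all add: I_def)
  have "(\<lambda>(x, y). indicator S y *\<^sub>R F x y) \<in> borel_measurable (borel \<Otimes>\<^sub>M lborel)"
    using F unfolding S_def by measurable
  then have I_meas: "I \<in> borel_measurable borel"
    unfolding I_def set_lebesgue_integral_def
    by (rule sigma_finite_measure.borel_measurable_lebesgue_integral[OF lborel.sigma_finite_measure_axioms])
  have I_bound: "\<bar>I x\<bar> \<le> B * (b - a)" if "x \<in> S" for x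
  proof -
    have const: "((\<lambda>_. B) has_integral B * (b - a)) S"
      using has_integral_const_real[of B a b] that by (simp add: S_def has_integral_Icc_iff_Ioo mult.commute)
    have "norm (integral S (F x)) \<le> integral S (\<lambda>_. B)"
      using I(2)[OF that] B[OF that] const by (intro integral_norm_bound_integral) auto
    then show ?thesis
      using I(1)[OF that] integral_unique[OF const] by simp
  qed
  have "I integrable_on S"
    using set_borel_integral_eq_integral(1)[OF set_integrable_bounded_interval[OF I_meas I_bound[unfolded S_def]]]
    by (simp add: S_def)
  then have outer: "(\<lambda>x. integral S (F x)) integrable_on S"
    using I(1) by (simp cong: integrable_cong)
  show "r \<le> integral S (\<lambda>x. integral S (F x))" if "\<And>x y. x \<in> S \<Longrightarrow> y \<in> S \<Longrightarrow> P x y \<le> F x y"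
  proof (rule has_integral_le[OF P(2) integrable_integral[OF outer]])
    show "p x \<le> integral S (F x)" if "x \<in> S" for x
      using that \<open>\<And>x y. x \<in> S \<Longrightarrow> y \<in> S \<Longrightarrow> P x y \<le> F x y\<close>
      by (intro has_integral_le[OF P(1) integrable_integral[OF I(2)]])
  qed
  show "integral S (\<lambda>x. integral S (F x)) \<le> r" if "\<And>x y. x \<in> S \<Longrightarrow> y \<in> S \<Longrightarrow> F x y \<le> P x y"
  proof (rule has_integral_le[OF integrable_integral[OF outer] P(2)])
    show "integral S (F x) \<le> p x" if "x \<in> S" for x
      using that \<open>\<And>x y. x \<in> S \<Longrightarrow> y \<in> S \<Longrightarrow> F x y \<le> P x y\<close>
      by (intro has_integral_le[OF integrable_integral[OF I(2)] P(1)])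
  qed
qed

text \<open>Sparse polynomials as lists of coefficient, exponent of \<open>m\<close>, exponent of
  \<open>n\<close>, so that integration becomes a computation on the list.\<close>

definition polysum :: "(real \<times> nat \<times> nat) list \<Rightarrow> real \<Rightarrow> real \<Rightarrow> real" where
  "polysum cs m n = (\<Sum>(c, i, j)\<leftarrow>cs. c * m ^ i * n ^ j)"

text \<open>The mean of \<open>polysum\<close> for both expertness levels uniform on (1/2, 1): the
  k-th power of (2 x - 1)^2 has mean 1 / (2 k + 1).\<close>

definition polysum_mean :: "(real \<times> nat \<times> nat) list \<Rightarrow> real" where
  "polysum_mean cs = (\<Sum>(c, i, j)\<leftarrow>cs. c / ((2 * real i + 1) * (2 * real j + 1)))"

lemma has_integral_skill_power:
  "((\<lambda>x :: real. ((2 * x - 1)\<^sup>2) ^ k) has_integral 1 / (2 * (2 * real k + 1))) {1/2<..<1}"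
proof -
  have "((\<lambda>x. (2 * x - 1) ^ Suc (2 * k) / (2 * real (Suc (2 * k)))) has_real_derivative ((2 * x - 1)\<^sup>2) ^ k)
      (at x within {1/2..1})" for x :: real
    by (auto intro!: derivative_eq_intros simp: power_mult[symmetric] simp del: of_nat_Suc power_Suc)
  then have "((\<lambda>x :: real. ((2 * x - 1)\<^sup>2) ^ k) has_integral
      (2 * 1 - 1) ^ Suc (2 * k) / (2 * real (Suc (2 * k))) - (2 * (1/2) - 1) ^ Suc (2 * k) / (2 * real (Suc (2 * k))))
      {1/2..1}"
    by (intro fundamental_theorem_of_calculus) (auto simp flip: has_real_derivative_iff_has_vector_derivative)
  then show ?thesis
    by (simp add: has_integral_Icc_iff_Ioo add.commute)
qed

lemma has_integral_sum_list:
  assumes "\<And>c. c \<in> set cs \<Longrightarrow> (f c has_integral i c) S"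
  shows "((\<lambda>x. \<Sum>c\<leftarrow>cs. f c x) has_integral (\<Sum>c\<leftarrow>cs. i c)) S"
  using assms by (induction cs) (auto intro: has_integral_add)

text \<open>The 4 is the uniform density on the square; integrating over \<open>y\<close> uses up a
  factor 2 of it and leaves 2 for the outer integral.\<close>

lemma has_integral_polysum_inner:
  "((\<lambda>y. 4 * polysum cs ((2 * y - 1)\<^sup>2) n) has_integral
     (\<Sum>(c, i, j)\<leftarrow>cs. 2 * c * n ^ j / (2 * real i + 1))) {1/2<..<1}"
proof -
  have "((\<lambda>y. 4 * ((\<lambda>(c, i, j). c * ((2 * y - 1)\<^sup>2) ^ i * n ^ j) t)) has_integral
      (\<lambda>(c, i, j). 2 * c * n ^ j / (2 * real i + 1)) t) {1/2<..<1}" for t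
  proof (cases t)
    case (fields c i j)
    have eq: "4 * d * (1 / (2 * A)) = 2 * d / A" for d A :: real
      by simp
    show ?thesis
      using has_integral_mult_right[OF has_integral_skill_power[of i], of "4 * (c * n ^ j)"]
      unfolding eq by (simp add: fields mult_ac)
  qed
  from has_integral_sum_list[where cs = cs, OF this] show ?thesis
    by (simp add: polysum_def sum_list_const_mult)
qed

lemma has_integral_polysum_outer:
  "((\<lambda>x. \<Sum>(c, i, j)\<leftarrow>cs. 2 * c * ((2 * x - 1)\<^sup>2) ^ j / (2 * real i + 1)) has_integral
     polysum_mean cs) {1/2<..<1}"
proof -
  have "((\<lambda>x. (\<lambda>(c, i, j). 2 * c * ((2 * x - 1)\<^sup>2) ^ j / (2 * real i + 1)) t) has_integral
      (\<lambda>(c, i, j). c / ((2 * real i + 1) * (2 * real j + 1))) t) {1/2<..<1}" for t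
  proof (cases t)
    case (fields c i j)
    have eq: "2 * c / A * (1 / (2 * B)) = c / (A * B)" for A B :: real
      by simp
    show ?thesis
      using has_integral_mult_right[OF has_integral_skill_power[of j], of "2 * c / (2 * real i + 1)"]
      unfolding eq by (simp add: fields mult_ac)
  qed
  from has_integral_sum_list[where cs = cs, OF this] show ?thesis
    by (simp add: polysum_mean_def)
qed

text \<open>This list and the next five are expansions of \<open>gain\<close> with polynomial bounds
  substituted for \<open>f\<close> and \<open>g\<close>; \<open>polysum_bounds\<close> records the
  substitutions.\<close>

definition lower_FF :: "(real \<times> nat \<times> nat) list" where
  "lower_FF =
    [(5/16, 0, 2), (3/8, 0, 3), (1/16, 0, 4), (-5/16, 1, 2), (-3/4, 1, 3), (1/16, 1, 4), (3/8,
     1, 5), (-5/16, 2, 2), (3/8, 2, 3), (1/16, 2, 4), (-3/4, 2, 5), (5/16, 3, 2), (-9/16, 3, 4),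
     (3/8, 3, 5), (3/8, 4, 4)]"

definition upper_FF :: "(real \<times> nat \<times> nat) list" where
  "upper_FF =
    [(1/3, 0, 2), (1/3, 0, 3), (1/12, 0, 4), (-5/16, 1, 2), (-17/24, 1, 3), (3/8, 1, 5), (7/48,
     1, 6), (-1/3, 2, 2), (3/8, 2, 3), (7/16, 2, 4), (-3/8, 2, 5), (-5/12, 2, 6), (1/16, 2, 8),
     (5/16, 3, 2), (-7/12, 3, 4), (19/48, 3, 6), (-1/8, 3, 8), (1/16, 4, 4), (-1/8, 4, 6),
     (1/16, 4, 8)]"

definition lower_TF :: "(real \<times> nat \<times> nat) list" where
  "lower_TF =
    [(1/3, 0, 2), (1/12, 0, 3), (1/24, 0, 4), (-1/2, 1, 2), (-1/6, 1, 3), (-1/6, 1, 4), (1/12,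
     2, 3), (1/4, 2, 4), (1/6, 3, 2), (-1/6, 3, 4), (1/24, 4, 4)]"

definition upper_TF :: "(real \<times> nat \<times> nat) list" where
  "upper_TF =
    [(1/3, 0, 2), (1/12, 0, 3), (1/24, 0, 4), (-23/48, 1, 2), (-17/96, 1, 3), (5/32, 1, 4),
     (3/32, 1, 5), (7/96, 1, 6), (-1/96, 2, 2), (3/32, 2, 3), (1/16, 2, 4), (-3/32, 2, 5),
     (-5/24, 2, 6), (1/32, 2, 8), (5/32, 3, 2), (-7/24, 3, 4), (19/96, 3, 6), (-1/16, 3, 8),
     (1/32, 4, 4), (-1/16, 4, 6), (1/32, 4, 8)]"

definition lower_TT :: "(real \<times> nat \<times> nat) list" where
  "lower_TT =
    [(5/16, 0, 2), (-1/16, 0, 4), (-15/16, 1, 2), (1/4, 1, 4), (15/16, 2, 2), (-3/8, 2, 4),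
     (-5/16, 3, 2), (1/4, 3, 4), (-1/16, 4, 4)]"

definition upper_TT :: "(real \<times> nat \<times> nat) list" where
  "upper_TT =
    [(1/3, 0, 2), (-1/12, 0, 4), (-47/48, 1, 2), (5/8, 1, 4), (-7/48, 1, 6), (23/24, 2, 2),
     (-17/16, 2, 4), (5/12, 2, 6), (-1/16, 2, 8), (-5/16, 3, 2), (7/12, 3, 4), (-19/48, 3, 6),
     (1/8, 3, 8), (-1/16, 4, 4), (1/8, 4, 6), (-1/16, 4, 8)]"

lemmas bound_defs = lower_FF_def upper_FF_def lower_TF_def upper_TF_def lower_TT_def upper_TT_def

text \<open>The means are explicit rationals; the thresholds are the ends of the intervals of radius
  0.005 about 0.08, 0.05 and 0.03.\<close>

lemma polysum_mean_bounds:
  "0.075 \<le> polysum_mean lower_FF"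
  "0.085 \<ge> polysum_mean upper_FF"
  "0.045 \<le> polysum_mean lower_TF"
  "0.055 \<ge> polysum_mean upper_TF"
  "0.025 \<le> polysum_mean lower_TT"
  "0.035 \<ge> polysum_mean upper_TT"
  by (simp_all add: polysum_mean_def bound_defs)

text \<open>In state (False, False) the bound \<open>(1 - m) n\<^sup>2\<close> for \<open>f\<close> alone gives an average below 0.075,
  so the linear term uses the next term of the geometric series as well.\<close>
lemma polysum_bounds:
  fixes m n :: real
  defines "e \<equiv> (1 - m) / 2"
  defines "f \<equiv> (1 - m) * n\<^sup>2" and "f' \<equiv> (1 - m) * n\<^sup>2 + m * n ^ 4"
  shows "polysum lower_FF m n = gain (False, False) n e f 0 + e / 4 * (5 + 3 * n - 5 * e) * (f * m * n\<^sup>2)"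
    and "polysum upper_FF m n = gain (False, False) n e f' (n\<^sup>2 / 9)"
    and "polysum lower_TF m n = gain (True, False) n e f (f / 9)"
    and "polysum upper_TF m n = gain (True, False) n e f' (n\<^sup>2 / 9)"
    and "polysum lower_TT m n = gain (True, True) n e f 0"
    and "polysum upper_TT m n = gain (True, True) n e f' (n\<^sup>2 / 9)"
  by (simp_all add: polysum_def bound_defs e_def f_def f'_def eval_nat_numeral field_simps)

section \<open>Evaluation of contentedness\<close>

text \<open>Defined on the whole plane, so that measurability can be read off the formula; it is
  compared with the improvement on \<open>expertness\<close> only.\<close>

definition impact :: "state \<Rightarrow> real \<Rightarrow> real \<Rightarrow> real" where
  "impact V p1 p2 = (let n = (2 * p1 - 1)\<^sup>2; m = (2 * p2 - 1)\<^sup>2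
     in gain V n ((1 - m) / 2) (learn m n) (learn m (n / 3)))"

lemma contentedness_impact:
  "p \<in> expertness \<Longrightarrow> contentedness_OL V p - contentedness_NL V p = impact V (fst p) (snd p)"
  using contentedness_gain[of "fst p" "snd p" V] by (simp add: impact_def Let_def)

lemma skill_bounds:
  fixes q :: real
  assumes "q \<in> {1/2<..<1}"
  shows "0 < (2 * q - 1)\<^sup>2" "(2 * q - 1)\<^sup>2 < 1"
  using assms by (auto simp: abs_square_less_1)

lemma impact_nonneg: "p1 \<in> {1/2<..<1} \<Longrightarrow> p2 \<in> {1/2<..<1} \<Longrightarrow> 0 \<le> impact V p1 p2"
  unfolding impact_def Let_def by (intro gain_nonneg skill_bounds)

lemma impact_le:
  assumes "p1 \<in> {1/2<..<1}" "p2 \<in> {1/2<..<1}"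
  shows "impact (False, False) p1 p2 \<le> 3 / 4"
    and "impact (True, False) p1 p2 \<le> 11 / 24"
    and "impact (False, True) p1 p2 \<le> 11 / 24"
    and "impact (True, True) p1 p2 \<le> 1 / 4"
  unfolding impact_def Let_def
  by (rule gain_le[OF skill_bounds[OF assms(2)] skill_bounds[OF assms(1)]])+

lemma impact_le_1:
  assumes "p1 \<in> {1/2<..<1}" "p2 \<in> {1/2<..<1}"
  shows "impact V p1 p2 \<le> 1"
  using impact_le[OF assms] by (cases V rule: state_cases) auto

lemma contentedness_le:
  assumes "p \<in> expertness"
  shows "contentedness_NL V p \<le> contentedness_OL V p"
  using contentedness_impact[OF assms, of V] impact_nonneg[of "fst p" "snd p" V] assms
  by (auto simp: expertness_def)

section \<open>Maximum improvement\<close>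

lemma improvement_set_contentedness:
  "improvement_set contentedness_OL contentedness_NL V = expertness"
  by (auto simp: improvement_set_def contentedness_le)

lemma max_improvement_bounds:
  assumes le: "\<And>p1 p2. p1 \<in> {1/2<..<1} \<Longrightarrow> p2 \<in> {1/2<..<1} \<Longrightarrow> impact V p1 p2 \<le> u"
    and l: "l \<le> impact V (999/1000) (501/1000)"
  shows "max_improvement contentedness_OL contentedness_NL V \<in> {l..u}"
proof -
  have eq: "max_improvement contentedness_OL contentedness_NL V = (SUP p\<in>expertness. impact V (fst p) (snd p))"
    unfolding max_improvement_def improvement_set_contentedness
    by (rule SUP_cong) (simp_all add: contentedness_impact)
  have le': "impact V (fst p) (snd p) \<le> u" if "p \<in> expertness" for p
    using that by (intro le) (auto simp: expertness_def)
  \<comment> \<open>A point close to the corner (1, 1/2), where the upper bounds are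
    approached.\<close>
  have p: "(999/1000, 501/1000) \<in> expertness"
    by (simp add: expertness_def)
  have "l \<le> (SUP p\<in>expertness. impact V (fst p) (snd p))"
    by (rule cSUP_upper2[OF _ p]) (use le' l in \<open>auto intro!: bdd_aboveI2\<close>)
  moreover have "(SUP p\<in>expertness. impact V (fst p) (snd p)) \<le> u"
    by (rule cSUP_least) (use p le' in auto)
  ultimately show ?thesis
    by (simp add: eq)
qed

lemma max_improvement_contentedness:
  "max_improvement contentedness_OL contentedness_NL (False, False) \<in> {0.74..3/4}"
  "max_improvement contentedness_OL contentedness_NL (True, False) \<in> {0.45..11/24}"
  "max_improvement contentedness_OL contentedness_NL (False, True) \<in> {0.45..11/24}"
  "max_improvement contentedness_OL contentedness_NL (True, True) \<in> {0.245..1/4}"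
  by (rule max_improvement_bounds, erule (1) impact_le,
      simp add: impact_def learn_def power2_eq_square)+

section \<open>Average impact\<close>

lemma impact_measurable: "(\<lambda>(x, y). 4 * impact V x y) \<in> borel_measurable (borel \<Otimes>\<^sub>M borel)"
  by (cases V rule: state_cases) (simp_all add: impact_def Let_def learn_def)

lemma average_impact_eq:
  "average_impact contentedness_OL contentedness_NL V =
    integral {1/2<..<1} (\<lambda>p1. integral {1/2<..<1} (\<lambda>p2. 4 * impact V p1 p2))"
  unfolding average_impact_def
  by (intro integral_cong) (simp add: contentedness_impact expertness_def)

lemma average_impact_ge:
  assumes "\<And>m n. 0 < m \<Longrightarrow> m < 1 \<Longrightarrow> 0 < n \<Longrightarrow> n < 1 \<Longrightarrow>
    polysum cs m n \<le> gain V n ((1 - m) / 2) (learn m n) (learn m (n / 3))"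
  shows "polysum_mean cs \<le> average_impact contentedness_OL contentedness_NL V"
  unfolding average_impact_eq
proof (rule iterated_integral_ge[OF impact_measurable _ has_integral_polysum_inner has_integral_polysum_outer])
  fix x y :: real
  assume "x \<in> {1/2<..<1}" "y \<in> {1/2<..<1}"
  then show "\<bar>4 * impact V x y\<bar> \<le> 4"
    using impact_nonneg[of x y V] impact_le_1[of x y V] by auto
qed (use assms skill_bounds in \<open>auto simp: impact_def Let_def\<close>)

lemma average_impact_le:
  assumes "\<And>m n. 0 < m \<Longrightarrow> m < 1 \<Longrightarrow> 0 < n \<Longrightarrow> n < 1 \<Longrightarrow>
    gain V n ((1 - m) / 2) (learn m n) (learn m (n / 3)) \<le> polysum cs m n"
  shows "average_impact contentedness_OL contentedness_NL V \<le> polysum_mean cs"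
  unfolding average_impact_eq
proof (rule iterated_integral_le[OF impact_measurable _ has_integral_polysum_inner has_integral_polysum_outer])
  fix x y :: real
  assume "x \<in> {1/2<..<1}" "y \<in> {1/2<..<1}"
  then show "\<bar>4 * impact V x y\<bar> \<le> 4"
    using impact_nonneg[of x y V] impact_le_1[of x y V] by auto
qed (use assms skill_bounds in \<open>auto simp: impact_def Let_def\<close>)

context
  fixes m n :: real
  assumes m: "0 < m" "m < 1" and n: "0 < n" "n < 1"
begin

text \<open>\<open>f\<close> is replaced by the tangent bound of \<open>learn_bounds\<close> and
  \<open>g\<close> by \<open>n\<^sup>2 / 9\<close>; both stay at most 1, as
  \<open>gain_learn_le\<close> requires.\<close>

lemma gain_polysum_upper:
  "gain (False, False) n ((1 - m) / 2) (learn m n) (learn m (n / 3)) \<le> polysum upper_FF m n"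
  "gain (True, False) n ((1 - m) / 2) (learn m n) (learn m (n / 3)) \<le> polysum upper_TF m n"
  "gain (True, True) n ((1 - m) / 2) (learn m n) (learn m (n / 3)) \<le> polysum upper_TT m n"
proof -
  have n2: "n\<^sup>2 \<le> 1" "n ^ 4 \<le> n\<^sup>2"
    using n power_decreasing[of 2 4 n] by (simp_all add: power_le_one)
  then have "m * n ^ 4 \<le> m * n\<^sup>2"
    using m by (intro mult_left_mono) auto
  then have f: "(1 - m) * n\<^sup>2 + m * n ^ 4 \<le> 1"
    using n2 by (simp add: left_diff_distrib)
  show "gain (False, False) n ((1 - m) / 2) (learn m n) (learn m (n / 3)) \<le> polysum upper_FF m n"
    "gain (True, False) n ((1 - m) / 2) (learn m n) (learn m (n / 3)) \<le> polysum upper_TF m n"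
    "gain (True, True) n ((1 - m) / 2) (learn m n) (learn m (n / 3)) \<le> polysum upper_TT m n"
    unfolding polysum_bounds using m n n2 f
    by (intro gain_learn_le learn_bounds(3); simp)+
qed

lemma gain_polysum_lower:
  "polysum lower_FF m n \<le> gain (False, False) n ((1 - m) / 2) (learn m n) (learn m (n / 3))"
  "polysum lower_TF m n \<le> gain (True, False) n ((1 - m) / 2) (learn m n) (learn m (n / 3))"
  "polysum lower_TT m n \<le> gain (True, True) n ((1 - m) / 2) (learn m n) (learn m (n / 3))"
proof -
  have n3: "0 < n / 3" "n / 3 < 1"
    using n by simp_all
  have g: "(1 - m) * n\<^sup>2 / 9 \<le> learn m (n / 3)" "0 \<le> learn m (n / 3)"
    using learn_bounds(1)[OF m n3] learn_nonneg[OF m n3] by (simp_all add: power_divide)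
  have f: "(1 - m) * n\<^sup>2 \<le> learn m n"
    by (rule learn_bounds(1)[OF m n])
  show "polysum lower_TF m n \<le> gain (True, False) n ((1 - m) / 2) (learn m n) (learn m (n / 3))"
    "polysum lower_TT m n \<le> gain (True, True) n ((1 - m) / 2) (learn m n) (learn m (n / 3))"
    unfolding polysum_bounds using m n f g by (intro gain_learn_ge; simp)+
  define e where "e = (1 - m) / 2"
  define h where "h = (1 - m) * n\<^sup>2"
  have e: "0 \<le> e" "e \<le> 1 / 2"
    using m by (simp_all add: e_def)
  have h: "0 \<le> h" "h * (1 + m * n\<^sup>2) \<le> learn m n" "h \<le> learn m n"
    using m n f learn_bounds(2)[OF m n] by (simp_all add: h_def)
  \<comment> \<open>Two different lower bounds for \<open>f\<close> occur here, the sharper one in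
    the linear term only, so \<open>gain_learn_ge\<close> does not apply directly. At g = 0 both
    coefficients are nonnegative because e is at most 1/2, and the terms are compared separately;
    \<open>g\<close> is restored last.\<close>
  have "polysum lower_FF m n = e / 4 * ((5 + 3 * n - 5 * e) * (h * (1 + m * n\<^sup>2)) + e * h\<^sup>2)"
    unfolding polysum_bounds e_def[symmetric] h_def[symmetric] by (simp add: algebra_simps)
  also have "\<dots> \<le> e / 4 * ((5 + 3 * n - 5 * e) * learn m n + e * (learn m n)\<^sup>2)"
    using e h n by (intro mult_left_mono add_mono power_mono) auto
  also have "\<dots> = gain (False, False) n e (learn m n) 0"
    by simp
  also have "\<dots> \<le> gain (False, False) n e (learn m n) (learn m (n / 3))"
    unfolding e_def using m n g learn_nonneg[OF m n] by (intro gain_learn_ge) auto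
  finally show "polysum lower_FF m n \<le> gain (False, False) n ((1 - m) / 2) (learn m n) (learn m (n / 3))"
    by (simp add: e_def)
qed

end

lemma average_impact_contentedness:
  "average_impact contentedness_OL contentedness_NL (False, False) \<in> {0.075..0.085}"
  "average_impact contentedness_OL contentedness_NL (True, False) \<in> {0.045..0.055}"
  "average_impact contentedness_OL contentedness_NL (False, True) \<in> {0.045..0.055}"
  "average_impact contentedness_OL contentedness_NL (True, True) \<in> {0.025..0.035}"
proof -
  have swap: "gain (False, True) = gain (True, False)"
    by (simp add: fun_eq_iff)
  have "polysum_mean lower_FF \<le> average_impact contentedness_OL contentedness_NL (False, False)"
    "polysum_mean lower_TF \<le> average_impact contentedness_OL contentedness_NL (True, False)"
    "polysum_mean lower_TF \<le> average_impact contentedness_OL contentedness_NL (False, True)"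
    "polysum_mean lower_TT \<le> average_impact contentedness_OL contentedness_NL (True, True)"
    by (rule average_impact_ge, simp only: swap gain_polysum_lower)+
  moreover have "average_impact contentedness_OL contentedness_NL (False, False) \<le> polysum_mean upper_FF"
    "average_impact contentedness_OL contentedness_NL (True, False) \<le> polysum_mean upper_TF"
    "average_impact contentedness_OL contentedness_NL (False, True) \<le> polysum_mean upper_TF"
    "average_impact contentedness_OL contentedness_NL (True, True) \<le> polysum_mean upper_TT"
    by (rule average_impact_le, simp only: swap gain_polysum_upper)+
  moreover note polysum_mean_bounds
  ultimately show "average_impact contentedness_OL contentedness_NL (False, False) \<in> {0.075..0.085}"
    "average_impact contentedness_OL contentedness_NL (True, False) \<in> {0.045..0.055}"
    "average_impact contentedness_OL contentedness_NL (False, True) \<in> {0.045..0.055}"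
    "average_impact contentedness_OL contentedness_NL (True, True) \<in> {0.025..0.035}"
    unfolding atLeastAtMost_iff by linarith+
qed

theorem proposition1:
  shows "(\<forall>V. harm_set contentedness_OL contentedness_NL V = {})
    \<and> (\<forall>V. average_impact contentedness_OL contentedness_NL V > 0)
    \<and> max_improvement contentedness_OL contentedness_NL (False, False) \<in> {0.74..0.75}
    \<and> max_improvement contentedness_OL contentedness_NL (True, False) \<in> {0.45..0.46}
    \<and> max_improvement contentedness_OL contentedness_NL (False, True) \<in> {0.45..0.46}
    \<and> \<bar>max_improvement contentedness_OL contentedness_NL (True, True) - 0.25\<bar> \<le> 0.005
    \<and> \<bar>average_impact contentedness_OL contentedness_NL (False, False) - 0.08\<bar> \<le> 0.005
    \<and> \<bar>average_impact contentedness_OL contentedness_NL (True, False) - 0.05\<bar> \<le> 0.005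
    \<and> \<bar>average_impact contentedness_OL contentedness_NL (False, True) - 0.05\<bar> \<le> 0.005
    \<and> \<bar>average_impact contentedness_OL contentedness_NL (True, True) - 0.03\<bar> \<le> 0.005"
proof -
  have harm: "harm_set contentedness_OL contentedness_NL V = {}" for V
    by (auto simp: harm_set_def not_less contentedness_le)
  have average: "average_impact contentedness_OL contentedness_NL V > 0" for V
    using average_impact_contentedness by (cases V rule: state_cases) auto
  show ?thesis
    using average_impact_contentedness max_improvement_contentedness
    unfolding atLeastAtMost_iff abs_le_iff by (intro conjI allI harm average; simp)
qed

end
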